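(* Let $p\in(-\infty,-1]\cup[0,\infty)$. Then the inequality $$\frac{\sin t}{t}<\frac{2p+(p+3)\cos t}{(3p+1)+2\cos t}$$ holds for all $t\in(0,\pi/2)$ if and only if $p\in(-\infty,-1]\cup[9,\infty)$. Moreover, for every $p\in(-\infty,-1]\cup[9,\infty)$ and all $t\in(0,\pi/2)$, $$H_2(\cos t,p)=\lambda_p\,\frac{2p+(p+3)\cos t}{(3p+1)+2\cos t}<\frac{\sin t}{t}<\frac{2p+(p+3)\cos t}{(3p+1)+2\cos t}=H_1(\cos t,p),$$ where the constant $\lambda_p=\dfrac{3p+1}{\pi p}$ is the best possible. Furthermore, for each $t\in(0,\pi/2)$, the lower bound $H_2(\cos t,p)$ is decreasing in $p$ and the upper bound $H_1(\cos t,p)$ is increasing in $p$ on each of the intervals $(-\infty,-1]$ and $(0,\infty)$.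
   Context: For $x\in(0,1)$: $H_1(x,p)=\dfrac{2p+(p+3)x}{3p+1+2x}$ for $p\in(-\infty,-1]\cup[0,\infty)$, and $H_2(x,p)=\dfrac{3p+1}{\pi p}\cdot\dfrac{2p+(p+3)x}{3p+1+2x}$ for $p\in(-\infty,-1]\cup(0,\infty)$. "$\lambda_p$ is the best possible" means that $\lambda_p$ is the largest constant $\lambda$ for which $\lambda H_1(\cos t,p)<\frac{\sin t}{t}$ holds for all $t\in(0,\pi/2)$. *)

theory Defs
  imports Complex_Main
begin

definition H\<^sub>1 :: "real \<Rightarrow> real \<Rightarrow> real" where
  "H\<^sub>1 x p = (2 * p + (p + 3) * x) / (3 * p + 1 + 2 * x)"

definition H\<^sub>2 :: "real \<Rightarrow> real \<Rightarrow> real" where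
  "H\<^sub>2 x p = (3 * p + 1) / (pi * p) * ((2 * p + (p + 3) * x) / (3 * p + 1 + 2 * x))"

definition lambda_const :: "real \<Rightarrow> real" where
  "lambda_const p = (3 * p + 1) / (pi * p)"

definition admissible_const :: "real \<Rightarrow> real \<Rightarrow> bool" where
  "admissible_const p l \<longleftrightarrow> (\<forall>t\<in>{0<..<pi/2}. l * H\<^sub>1 (cos t) p < sin t / t)"

(* "Best possible" means largest, and the maximum has to be attained. *)
definition best_possible_const :: "real \<Rightarrow> real \<Rightarrow> bool" where
  "best_possible_const p l \<longleftrightarrow>
     admissible_const p l \<and> (\<forall>m. admissible_const p m \<longrightarrow> m \<le> l)"

end

theory Submission
  imports Defs
begin

text \<open>
  Put \<open>N = 2 * p + (p + 3) * cos t\<close>, \<open>D = 3 * p + 1 + 2 * cos t\<close> and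
  \<open>\<phi> t = sin t * D / N\<close>. Since \<open>N / D\<close> is positive for the parameters in question, a bound
  \<open>l * N / D < sin t / t\<close> says \<open>l * t < \<phi> t\<close>, and the upper bound says \<open>\<phi> t < t\<close>. The rational
  function \<open>N / D\<close> is chosen so well that the derivative of \<open>\<phi>\<close> depends on \<open>t\<close> only through
  \<open>c = cos t\<close>, and in a very simple way: it is \<open>1 - g c\<close> with
  \<open>g c = (1 - c)\<^sup>2 * (p\<^sup>2 - 6 * p - 3 - 2 * (p + 3) * c) / N\<^sup>2\<close>.

  The linear factor has the values \<open>p\<^sup>2 - 6 * p - 3\<close> at \<open>c = 0\<close> and \<open>(p - 9) * (p + 1)\<close> at
  \<open>c = 1\<close>. If \<open>p < -1\<close> or \<open>9 \<le> p\<close>, the first is positive and the second nonnegative, so that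
  \<open>\<phi>\<close> grows more slowly than \<open>t\<close> and the upper bound holds; for \<open>0 \<le> p < 9\<close> the factor is
  negative when \<open>c\<close> is close to \<open>1\<close>, so that the upper bound fails for
  small \<open>t\<close>. This is where the threshold \<open>9\<close> comes from.

  For the same good parameters \<open>g\<close> is strictly decreasing in \<open>c\<close>, so \<open>\<phi>\<close> is strictly concave on
  \<open>[0, \<pi>/2]\<close> and lies above its chord. That chord has slope
  \<open>\<phi> (\<pi>/2) / (\<pi>/2) = (3 * p + 1) / (\<pi> * p)\<close>, which is the constant in the lower bound; letting \<open>t\<close>
  tend to \<open>\<pi>/2\<close> shows that it cannot be enlarged. At \<open>p = -1\<close> both \<open>N\<close> and \<open>D\<close> vanish at \<open>t = 0\<close>;
  there the bounds are inherited from \<open>p = -2\<close> by monotonicity in \<open>p\<close>.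
\<close>

section \<open>The rational function and its monotonicity in the parameter\<close>

definition num :: "real \<Rightarrow> real \<Rightarrow> real" where
  "num p c = 2 * p + (p + 3) * c"

definition den :: "real \<Rightarrow> real \<Rightarrow> real" where
  "den p c = 3 * p + 1 + 2 * c"

lemma H1_eq_num_den: "H\<^sub>1 c p = num p c / den p c"
  by (simp add: H\<^sub>1_def num_def den_def)

lemma H2_eq_lambda_H1: "H\<^sub>2 c p = lambda_const p * H\<^sub>1 c p"
  by (simp add: H\<^sub>2_def H\<^sub>1_def lambda_const_def)

lemma cos_unit_interval:
  assumes "t \<in> {0<..<pi/2}"
  shows "0 < cos t" "cos t < 1"
  using assms cos_monotone_0_pi[of 0 t] by (auto intro: cos_gt_zero)

lemma den_neg: "p \<le> -1 \<Longrightarrow> c < 1 \<Longrightarrow> den p c < 0"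
  by (simp add: den_def)

lemma den_pos: "0 \<le> p \<Longrightarrow> 0 \<le> c \<Longrightarrow> 0 < den p c"
  by (simp add: den_def)

text \<open>Affine in \<open>c\<close>, with the values \<open>2 * p\<close> and \<open>3 * (p + 1)\<close> at the two ends of the interval.\<close>

lemma num_neg:
  assumes "p \<le> -1" "0 \<le> c" "c < 1 \<or> p < -1 \<and> c = 1"
  shows "num p c < 0"
proof -
  have eq: "num p c = (1 - c) * (2 * p) + c * (3 * (p + 1))"
    by (simp add: num_def algebra_simps)
  show ?thesis
  proof (cases "c < 1")
    case True
    then have "(1 - c) * (2 * p) < 0" "c * (3 * (p + 1)) \<le> 0"
      using assms by (simp_all add: mult_pos_neg mult_nonneg_nonpos)
    then show ?thesis using eq by linarith
  next
    case False
    then show ?thesis using assms eq by simp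
  qed
qed

lemma num_pos: "0 \<le> p \<Longrightarrow> 0 \<le> c \<Longrightarrow> 0 < p \<or> 0 < c \<Longrightarrow> 0 < num p c"
  unfolding num_def by (auto intro: add_pos_nonneg add_nonneg_pos)

lemma H1_diff:
  assumes "den p c \<noteq> 0" "den q c \<noteq> 0"
  shows "H\<^sub>1 c q - H\<^sub>1 c p = 2 * (1 - c)\<^sup>2 * (q - p) / (den p c * den q c)"
proof -
  have "num q c * den p c - num p c * den q c = 2 * (1 - c)\<^sup>2 * (q - p)"
    unfolding num_def den_def by algebra
  then show ?thesis
    using assms by (simp add: H1_eq_num_den diff_frac_eq mult.commute)
qed

lemma H1_less:
  assumes "p < q" "c < 1" "0 < den p c * den q c"
  shows "H\<^sub>1 c p < H\<^sub>1 c q"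
proof -
  have "0 < 2 * (1 - c)\<^sup>2 * (q - p) / (den p c * den q c)"
    using assms by simp
  moreover have "den p c \<noteq> 0" "den q c \<noteq> 0" using assms by auto
  ultimately show ?thesis using H1_diff[of p c q] by simp
qed

lemma H1_strict_mono_neg:
  assumes "c < 1"
  shows "strict_mono_on {..-1} (\<lambda>p. H\<^sub>1 c p)"
  using assms by (auto intro!: strict_mono_onI H1_less mult_neg_neg den_neg)

lemma H1_strict_mono_pos:
  assumes "0 \<le> c" "c < 1"
  shows "strict_mono_on {0<..} (\<lambda>p. H\<^sub>1 c p)"
  using assms by (auto intro!: strict_mono_onI H1_less mult_pos_pos den_pos)

text \<open>
  In the logarithmic derivative of \<open>H\<^sub>2\<close> with respect to \<open>p\<close>, the growth of \<open>H\<^sub>1\<close> and the decay of the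
  constant compete; the factored form settles which of them wins.
\<close>

lemma H2_deriv_parameter:
  assumes "p \<noteq> 0" "den p c \<noteq> 0"
  shows "((\<lambda>p. H\<^sub>2 c p) has_real_derivative
          - (3 * c * ((p + 1) * (5 * p + 1 - 2 * c * (p - 1)))) / (pi * (p * den p c)\<^sup>2)) (at p)"
proof -
  have fn: "(\<lambda>p. H\<^sub>2 c p) = (\<lambda>p. (3 * p + 1) * num p c / (p * den p c) / pi)"
    by (rule ext) (simp add: H\<^sub>2_def num_def den_def field_simps)
  have n: "((\<lambda>p. num p c) has_real_derivative 2 + c) (at p)"
    unfolding num_def by (auto intro!: derivative_eq_intros)
  have d: "((\<lambda>p. den p c) has_real_derivative 3) (at p)"
    unfolding den_def by (auto intro!: derivative_eq_intros)
  have "((\<lambda>p. (3 * p + 1) * num p c / (p * den p c)) has_real_derivative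
      ((3 * num p c + (3 * p + 1) * (2 + c)) * (p * den p c)
        - (3 * p + 1) * num p c * (den p c + p * 3)) / ((p * den p c) * (p * den p c))) (at p)"
    using assms by (auto intro!: derivative_eq_intros n d simp: mult_ac add_ac)
  then have "((\<lambda>p. (3 * p + 1) * num p c / (p * den p c) / pi) has_real_derivative
      ((3 * num p c + (3 * p + 1) * (2 + c)) * (p * den p c)
        - (3 * p + 1) * num p c * (den p c + p * 3)) / ((p * den p c) * (p * den p c)) / pi) (at p)"
    by (rule DERIV_cdivide)
  moreover have "(3 * num p c + (3 * p + 1) * (2 + c)) * (p * den p c)
        - (3 * p + 1) * num p c * (den p c + p * 3)
      = - (3 * c * ((p + 1) * (5 * p + 1 - 2 * c * (p - 1))))"
    unfolding num_def den_def by algebra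
  ultimately show ?thesis
    unfolding fn by (simp add: power2_eq_square mult.commute)
qed

lemma H2_less:
  assumes "p < q" "0 < c"
    and nz: "\<And>r. p \<le> r \<Longrightarrow> r \<le> q \<Longrightarrow> r \<noteq> 0 \<and> den r c \<noteq> 0"
    and sign: "\<And>r. p < r \<Longrightarrow> r < q \<Longrightarrow> 0 < (r + 1) * (5 * r + 1 - 2 * c * (r - 1))"
  shows "H\<^sub>2 c q < H\<^sub>2 c p"
proof (rule DERIV_neg_imp_decreasing_open[OF assms(1)])
  fix r assume r: "p < r" "r < q"
  then have "0 < (r * den r c)\<^sup>2" using nz[of r] by simp
  then have "- (3 * c * ((r + 1) * (5 * r + 1 - 2 * c * (r - 1)))) / (pi * (r * den r c)\<^sup>2) < 0"
    using sign[OF r] assms(2) by (intro divide_neg_pos mult_pos_pos) auto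
  then show "\<exists>y. DERIV (\<lambda>p. H\<^sub>2 c p) r :> y \<and> y < 0"
    using H2_deriv_parameter[of r c] nz[of r] r by auto
next
  show "continuous_on {p..q} (\<lambda>p. H\<^sub>2 c p)"
    by (intro continuous_at_imp_continuous_on ballI DERIV_isCont[OF H2_deriv_parameter])
      (use nz in auto)
qed

lemma H2_strict_antimono_neg:
  assumes "0 < c" "c < 1"
  shows "strict_antimono_on {..-1} (\<lambda>p. H\<^sub>2 c p)"
proof (rule monotone_onI)
  fix p q :: real assume pq: "p \<in> {..-1}" "q \<in> {..-1}" "p < q"
  show "H\<^sub>2 c q < H\<^sub>2 c p"
  proof (rule H2_less[OF pq(3) assms(1)])
    fix r assume "p \<le> r" "r \<le> q"
    then show "r \<noteq> 0 \<and> den r c \<noteq> 0"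
      using pq assms den_neg[of r c] by auto
  next
    fix r assume "p < r" "r < q"
    then have r: "r < -1" using pq by auto
    then have "c * (1 - r) < 1 * (1 - r)"
      using assms by (intro mult_strict_right_mono) auto
    then have "5 * r + 1 - 2 * c * (r - 1) < 0"
      using r by (simp add: algebra_simps)
    then show "0 < (r + 1) * (5 * r + 1 - 2 * c * (r - 1))"
      using r by (intro mult_neg_neg) auto
  qed
qed

lemma H2_strict_antimono_pos:
  assumes "0 < c" "c < 1"
  shows "strict_antimono_on {0<..} (\<lambda>p. H\<^sub>2 c p)"
proof (rule monotone_onI)
  fix p q :: real assume pq: "p \<in> {0<..}" "q \<in> {0<..}" "p < q"
  show "H\<^sub>2 c q < H\<^sub>2 c p"
  proof (rule H2_less[OF pq(3) assms(1)])
    fix r assume "p \<le> r" "r \<le> q"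
    then show "r \<noteq> 0 \<and> den r c \<noteq> 0"
      using pq assms den_pos[of r c] by auto
  next
    fix r assume "p < r" "r < q"
    then have r: "0 < r" using pq by auto
    then have "c * r < 1 * r"
      using assms by (intro mult_strict_right_mono) auto
    moreover have "5 * r + 1 - 2 * c * (r - 1) = 5 * r + 1 - 2 * (c * r) + 2 * c"
      by (simp add: algebra_simps)
    ultimately have "0 < 5 * r + 1 - 2 * c * (r - 1)"
      using r assms by linarith
    then show "0 < (r + 1) * (5 * r + 1 - 2 * c * (r - 1))"
      using r by simp
  qed
qed

section \<open>The comparison function and its derivative\<close>

definition \<phi> :: "real \<Rightarrow> real \<Rightarrow> real" where
  "\<phi> p t = sin t * den p (cos t) / num p (cos t)"

definition lin :: "real \<Rightarrow> real \<Rightarrow> real" where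
  "lin p c = p\<^sup>2 - 6 * p - 3 - 2 * (p + 3) * c"

definition g :: "real \<Rightarrow> real \<Rightarrow> real" where
  "g p c = (1 - c)\<^sup>2 * lin p c / (num p c)\<^sup>2"

lemma phi_deriv:
  assumes "num p (cos t) \<noteq> 0"
  shows "(\<phi> p has_real_derivative 1 - g p (cos t)) (at t)"
proof -
  let ?N = "num p (cos t)" and ?D = "den p (cos t)"
  have n: "((\<lambda>t. num p (cos t)) has_real_derivative - (p + 3) * sin t) (at t)"
    unfolding num_def by (auto intro!: derivative_eq_intros simp: algebra_simps)
  have d: "((\<lambda>t. den p (cos t)) has_real_derivative - 2 * sin t) (at t)"
    unfolding den_def by (auto intro!: derivative_eq_intros)
  have "(\<phi> p has_real_derivative
      ((cos t * ?D + sin t * (- 2 * sin t)) * ?N - sin t * ?D * (- (p + 3) * sin t)) / (?N * ?N)) (at t)"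
    unfolding \<phi>_def using assms by (auto intro!: derivative_eq_intros n d)
  moreover have "(cos t * ?D + sin t * (- 2 * sin t)) * ?N - sin t * ?D * (- (p + 3) * sin t)
      = ?N\<^sup>2 - (1 - cos t)\<^sup>2 * lin p (cos t)"
    using sin_cos_squared_add[of t] unfolding num_def den_def lin_def by algebra
  moreover have "(?N\<^sup>2 - (1 - cos t)\<^sup>2 * lin p (cos t)) / (?N * ?N) = 1 - g p (cos t)"
    using assms by (simp add: g_def power2_eq_square diff_divide_distrib)
  ultimately show ?thesis by simp
qed

lemma less_sin_div_iff_phi:
  assumes "0 < t" "0 < num p (cos t) / den p (cos t)"
  shows "l * (num p (cos t) / den p (cos t)) < sin t / t \<longleftrightarrow> l * t < \<phi> p t"
proof -
  have eq: "\<phi> p t = sin t / (num p (cos t) / den p (cos t))" by (simp add: \<phi>_def)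
  show ?thesis
    unfolding eq using assms by (simp only: pos_less_divide_eq mult_ac)
qed

lemma sin_div_less_iff_phi:
  assumes "0 < t" "0 < num p (cos t) / den p (cos t)"
  shows "sin t / t < num p (cos t) / den p (cos t) \<longleftrightarrow> \<phi> p t < t"
proof -
  have eq: "\<phi> p t = sin t / (num p (cos t) / den p (cos t))" by (simp add: \<phi>_def)
  show ?thesis
    unfolding eq using assms by (simp only: pos_divide_less_eq pos_less_divide_eq mult_ac)
qed

text \<open>
  An affine function of \<open>c\<close> with the values \<open>p\<^sup>2 - 6 * p - 3\<close> and \<open>(p - 9) * (p + 1)\<close> at \<open>0\<close> and \<open>1\<close>.
\<close>

lemma lin_pos:
  assumes "p < -1 \<or> 9 \<le> p" "0 \<le> c" "c < 1"
  shows "0 < lin p c"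
proof -
  have eq: "lin p c = (1 - c) * (p\<^sup>2 - 6 * p - 3) + c * ((p - 9) * (p + 1))"
    unfolding lin_def by algebra
  have e1: "0 \<le> (p - 9) * (p + 1)"
    using assms(1) by (auto intro: mult_nonneg_nonneg mult_nonpos_nonpos)
  moreover have "(p - 9) * (p + 1) = p\<^sup>2 - 8 * p - 9"
    by (simp add: power2_eq_square algebra_simps)
  ultimately have "0 < p\<^sup>2 - 6 * p - 3"
    using assms(1) zero_le_power2[of p] by linarith
  then have "0 < (1 - c) * (p\<^sup>2 - 6 * p - 3)" using assms by simp
  moreover have "0 \<le> c * ((p - 9) * (p + 1))" using e1 assms by simp
  ultimately show ?thesis using eq by linarith
qed

lemma num_nonzero:
  assumes "p < -1 \<or> 9 \<le> p" "0 \<le> c" "c \<le> 1"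
  shows "num p c \<noteq> 0"
  using assms num_neg[of p c] num_pos[of p c] by fastforce

lemma H1_pos:
  assumes "p < -1 \<or> 9 \<le> p" "0 \<le> c" "c < 1"
  shows "0 < num p c / den p c"
  using assms num_neg[of p c] num_pos[of p c] den_neg[of p c] den_pos[of p c]
  by (auto simp: zero_less_divide_iff)

section \<open>The upper bound\<close>

lemma sin_div_less_H1:
  assumes p: "p < -1 \<or> 9 \<le> p" and t: "t \<in> {0<..<pi/2}"
  shows "sin t / t < num p (cos t) / den p (cos t)"
proof -
  have nz: "num p (cos u) \<noteq> 0" if "0 \<le> u" "u \<le> t" for u
    using that t p by (intro num_nonzero) (auto intro: cos_ge_zero)
  have "0 - \<phi> p 0 < t - \<phi> p t"
  proof (rule DERIV_pos_imp_increasing_open[where f = "\<lambda>u. u - \<phi> p u"])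
    show "0 < t" using t by simp
  next
    fix u assume u: "0 < u" "u < t"
    then have c: "0 < cos u" "cos u < 1" using cos_unit_interval[of u] t by auto
    have "0 < g p (cos u)"
      using lin_pos[OF p, of "cos u"] nz[of u] c u by (simp add: g_def)
    moreover have "((\<lambda>u. u - \<phi> p u) has_real_derivative 1 - (1 - g p (cos u))) (at u)"
      using nz[of u] u by (intro DERIV_diff DERIV_ident phi_deriv) auto
    ultimately show "\<exists>y. DERIV (\<lambda>u. u - \<phi> p u) u :> y \<and> 0 < y" by auto
  next
    show "continuous_on {0..t} (\<lambda>u. u - \<phi> p u)"
      using nz by (intro continuous_intros continuous_at_imp_continuous_on ballI
          DERIV_isCont[OF phi_deriv]) auto
  qed
  then have "\<phi> p t < t" by (simp add: \<phi>_def)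
  then show ?thesis
    using sin_div_less_iff_phi[of t p] H1_pos[OF p] cos_unit_interval[OF t] t by auto
qed

text \<open>
  For \<open>0 \<le> p < 9\<close> the root \<open>(p\<^sup>2 - 6 * p - 3) / (2 * (p + 3))\<close> of the linear factor is smaller than
  \<open>1\<close>, so the derivative of \<open>\<phi>\<close> exceeds \<open>1\<close> on a right neighbourhood of \<open>0\<close>.
\<close>

lemma upper_bound_fails:
  assumes p: "0 \<le> p" "p < 9"
  shows "\<exists>t\<in>{0<..<pi/2}. num p (cos t) / den p (cos t) < sin t / t"
proof -
  define m where "m = max 0 ((p\<^sup>2 - 6 * p - 3) / (2 * (p + 3)))"
  have "(p - 9) * (p + 1) < 0" using p by (intro mult_neg_pos) auto
  then have "p\<^sup>2 - 6 * p - 3 < 2 * (p + 3)" by (simp add: power2_eq_square algebra_simps)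
  then have m: "0 \<le> m" "m < 1" using p by (auto simp: m_def)
  \<comment> \<open>Halving keeps \<open>cos\<close> above \<open>m\<close> on \<open>[0, t]\<close>, endpoint included, and \<open>t\<close> below \<open>\<pi>/2\<close> if \<open>m = 0\<close>.\<close>
  define t where "t = arccos m / 2"
  have t: "0 < t" "2 * t \<le> pi/2"
    using m arccos_lt_bounded[of m] arccos_le_pi2[of m] arccos_less_arccos[of m 1]
    by (auto simp: t_def)
  have c: "m < cos u" "cos u < 1" if "0 < u" "u \<le> t" for u
  proof -
    have "cos (2 * t) < cos u"
      using that t by (intro cos_monotone_0_pi) auto
    then show "m < cos u" using m by (simp add: t_def)
    show "cos u < 1" using that t cos_unit_interval[of u] by auto
  qed
  have num: "0 < num p (cos u)" if "0 \<le> u" "u \<le> t" for u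
    using c[of u] m p that by (cases "u = 0") (auto intro: num_pos)
  have "0 - \<phi> p 0 > t - \<phi> p t"
  proof (rule DERIV_neg_imp_decreasing_open[where f = "\<lambda>u. u - \<phi> p u"])
    show "0 < t" by (rule t)
  next
    fix u assume u: "0 < u" "u < t"
    have "(p\<^sup>2 - 6 * p - 3) / (2 * (p + 3)) < cos u"
      using c(1)[of u] u by (simp add: m_def)
    then have "lin p (cos u) < 0"
      using p by (simp add: lin_def pos_divide_less_eq mult_ac)
    then have "g p (cos u) < 0"
      using num[of u] c(2)[of u] u
      by (simp add: g_def divide_neg_pos mult_pos_neg)
    moreover have "((\<lambda>u. u - \<phi> p u) has_real_derivative 1 - (1 - g p (cos u))) (at u)"
      using num[of u] u by (intro DERIV_diff DERIV_ident phi_deriv) auto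
    ultimately show "\<exists>y. DERIV (\<lambda>u. u - \<phi> p u) u :> y \<and> y < 0" by auto
  next
    show "continuous_on {0..t} (\<lambda>u. u - \<phi> p u)"
      using num by (intro continuous_intros continuous_at_imp_continuous_on ballI
          DERIV_isCont[OF phi_deriv]) (auto simp: less_imp_neq[symmetric])
  qed
  then have "1 * t < \<phi> p t" by (simp add: \<phi>_def)
  moreover have "0 < num p (cos t) / den p (cos t)"
    using num[of t] den_pos[of p "cos t"] c[of t] m p t by simp
  ultimately have "num p (cos t) / den p (cos t) < sin t / t"
    using less_sin_div_iff_phi[of t p 1] t by simp
  then show ?thesis using t by auto
qed

section \<open>The lower bound\<close>

lemma g_deriv:
  assumes "num p c \<noteq> 0"
  shows "(g p has_real_derivative
          - (2 * (1 - c) * (3 * (p + 1) * lin p c + (p + 3) * (1 - c) * num p c)) / (num p c)^3) (at c)"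
proof -
  have n: "((\<lambda>c. num p c) has_real_derivative p + 3) (at c)"
    unfolding num_def by (auto intro!: derivative_eq_intros)
  have l: "((\<lambda>c. lin p c) has_real_derivative - 2 * (p + 3)) (at c)"
    unfolding lin_def by (auto intro!: derivative_eq_intros)
  let ?N = "num p c" and ?L = "lin p c"
  have "(g p has_real_derivative
      ((- 2 * (1 - c) * ?L + (1 - c)\<^sup>2 * (- 2 * (p + 3))) * ?N\<^sup>2
        - (1 - c)\<^sup>2 * ?L * (2 * ?N * (p + 3))) / (?N\<^sup>2 * ?N\<^sup>2)) (at c)"
    unfolding g_def using assms by (auto intro!: derivative_eq_intros n l)
  moreover have "(- 2 * (1 - c) * ?L + (1 - c)\<^sup>2 * (- 2 * (p + 3))) * ?N\<^sup>2
        - (1 - c)\<^sup>2 * ?L * (2 * ?N * (p + 3))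
      = - (2 * (1 - c) * (3 * (p + 1) * ?L + (p + 3) * (1 - c) * ?N)) * ?N"
    unfolding num_def by algebra
  moreover have "x * ?N / (?N\<^sup>2 * ?N\<^sup>2) = x / ?N^3" for x
    using assms by (simp add: field_simps eval_nat_numeral)
  ultimately show ?thesis by simp
qed

text \<open>
  For \<open>-3 \<le> p < -1\<close> and for \<open>9 \<le> p\<close> neither summand in the derivative has
  the wrong sign. For
  \<open>p < -3\<close> the second one is of the wrong sign, but \<open>lin p c\<close> is at least \<open>- num p c\<close> and its
  coefficient dominates.
\<close>

lemma g_strict_antimono:
  assumes p: "p < -1 \<or> 9 \<le> p" and c: "0 \<le> c" "c < d" "d \<le> 1"
  shows "g p d < g p c"
proof (rule DERIV_neg_imp_decreasing_open[OF c(2)])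
  fix x assume "c < x" "x < d"
  then have x: "0 < x" "x < 1" using c by auto
  have L: "0 < lin p x" using lin_pos[OF p] x by simp
  define S where "S = 3 * (p + 1) * lin p x + (p + 3) * (1 - x) * num p x"
  have quotient: "0 < S / (num p x)^3"
  proof (cases "9 \<le> p")
    case True
    then have N: "0 < num p x" using x num_pos[of p x] by simp
    moreover have "0 < S" unfolding S_def using True L N x by (intro add_pos_pos mult_pos_pos) auto
    ultimately show ?thesis by simp
  next
    case False
    then have p1: "p < -1" using p by simp
    then have N: "num p x < 0" using x num_neg[of p x] by simp
    have "S < 0"
    proof (cases "-3 \<le> p")
      case True
      have "(3 * (p + 1)) * lin p x < 0" using p1 L by (intro mult_neg_pos[OF _ L]) simp
      moreover have "(p + 3) * (1 - x) * num p x \<le> 0"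
        using True N x by (intro mult_nonneg_nonpos) auto
      ultimately show ?thesis by (simp add: S_def)
    next
      case False
      have "lin p x + num p x = (p\<^sup>2 - 4 * p - 3) - (p + 3) * x"
        by (simp add: lin_def num_def algebra_simps)
      moreover have "(p + 3) * x \<le> 0" using False x by (intro mult_nonpos_nonneg) auto
      moreover have "0 < p\<^sup>2 - 4 * p - 3"
        using False zero_le_power2[of p] by linarith
      ultimately have "- num p x \<le> lin p x" by linarith
      then have "(1 - x) * (- num p x) \<le> 1 * lin p x"
        using x N by (intro mult_mono) auto
      then have "(- (p + 3)) * ((1 - x) * (- num p x)) \<le> (- (p + 3)) * lin p x"
        using False by (intro mult_left_mono) auto
      also have "\<dots> < - 3 * (p + 1) * lin p x"
        using p1 L by (intro mult_strict_right_mono) auto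
      finally show ?thesis by (simp add: S_def algebra_simps)
    qed
    moreover have "(num p x)^3 < 0" using N by (simp add: power_less_zero_eq)
    ultimately show ?thesis by (simp add: divide_neg_neg)
  qed
  have "- (2 * (1 - x) * S) / (num p x)^3 = - (2 * (1 - x) * (S / (num p x)^3))" by simp
  also have "\<dots> < 0" by (simp only: neg_less_0_iff_less, intro mult_pos_pos quotient) (use x in auto)
  finally show "\<exists>y. DERIV (g p) x :> y \<and> y < 0"
    using g_deriv[of p x] num_nonzero[OF p, of x] x by (auto simp: S_def)
next
  show "continuous_on {c..d} (g p)"
    using num_nonzero[OF p] c
    by (intro continuous_at_imp_continuous_on ballI DERIV_isCont[OF g_deriv]) auto
qed

lemma chord_below_of_decreasing_deriv:
  fixes f f' :: "real \<Rightarrow> real"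
  assumes t: "a < t" "t < b" and f: "\<And>x. a \<le> x \<Longrightarrow> x \<le> b \<Longrightarrow> (f has_real_derivative f' x) (at x)"
    and dec: "\<And>x y. a < x \<Longrightarrow> x < y \<Longrightarrow> y < b \<Longrightarrow> f' y < f' x"
  shows "(f b - f a) * (t - a) < (f t - f a) * (b - a)"
proof -
  obtain y where y: "a < y" "y < t" "f t - f a = (t - a) * f' y"
    using MVT2[of a t f f'] f t by auto
  obtain z where z: "t < z" "z < b" "f b - f t = (b - t) * f' z"
    using MVT2[of t b f f'] f t by auto
  have "f' z < f' y" using dec y z by auto
  then have "(b - t) * (t - a) * f' z < (b - t) * (t - a) * f' y"
    using t by (intro mult_strict_left_mono) auto
  then have "(f b - f t) * (t - a) < (f t - f a) * (b - t)"
    unfolding y(3) z(3) by (simp add: mult_ac)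
  then show ?thesis by (simp add: algebra_simps)
qed

lemma lambda_H1_less_sin_div:
  assumes p: "p < -1 \<or> 9 \<le> p" and t: "t \<in> {0<..<pi/2}"
  shows "lambda_const p * (num p (cos t) / den p (cos t)) < sin t / t"
proof -
  have "(\<phi> p (pi/2) - \<phi> p 0) * (t - 0) < (\<phi> p t - \<phi> p 0) * (pi/2 - 0)"
  proof (rule chord_below_of_decreasing_deriv)
    show "0 < t" "t < pi/2" using t by auto
    show "(\<phi> p has_real_derivative 1 - g p (cos x)) (at x)" if "0 \<le> x" "x \<le> pi/2" for x
      using that p by (intro phi_deriv num_nonzero) (auto intro: cos_ge_zero)
    show "1 - g p (cos y) < 1 - g p (cos x)" if "0 < x" "x < y" "y < pi/2" for x y
      using that cos_monotone_0_pi[of x y] cos_unit_interval[of x] cos_unit_interval[of y]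
        g_strict_antimono[OF p, of "cos y" "cos x"] by auto
  qed
  then have "(3 * p + 1) / (2 * p) * t < \<phi> p t * (pi/2)"
    by (simp add: \<phi>_def num_def den_def)
  moreover have "(3 * p + 1) / (2 * p) * t = lambda_const p * t * (pi/2)"
    by (simp add: lambda_const_def)
  ultimately have "lambda_const p * t < \<phi> p t" by simp
  then show ?thesis
    using less_sin_div_iff_phi[of t p] H1_pos[OF p] cos_unit_interval[OF t] t by auto
qed

section \<open>The closed parameter range and optimality\<close>

text \<open>
  The functions \<open>H\<^sub>1\<close> and \<open>H\<^sub>2\<close> are monotone in \<open>p\<close> in opposite directions, so both bounds
  become weaker as \<open>p\<close> increases from \<open>-2\<close> to \<open>-1\<close>.
\<close>

lemma two_sided_bound:
  assumes p: "p \<in> {..-1} \<union> {9..}" and t: "t \<in> {0<..<pi/2}"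
  shows "H\<^sub>2 (cos t) p < sin t / t" "sin t / t < H\<^sub>1 (cos t) p"
proof -
  note c = cos_unit_interval[OF t]
  have open_range: "H\<^sub>2 (cos t) q < sin t / t" "sin t / t < H\<^sub>1 (cos t) q" if "q < -1 \<or> 9 \<le> q" for q
    using lambda_H1_less_sin_div[OF that t] sin_div_less_H1[OF that t]
    by (simp_all add: H2_eq_lambda_H1 H1_eq_num_den)
  have "H\<^sub>2 (cos t) (-1) < H\<^sub>2 (cos t) (-2)"
    using monotone_onD[OF H2_strict_antimono_neg[OF c], of "-2" "-1"] by simp
  moreover have "H\<^sub>1 (cos t) (-2) < H\<^sub>1 (cos t) (-1)"
    using strict_mono_onD[OF H1_strict_mono_neg[OF c(2)], of "-2" "-1"] by simp
  ultimately have "H\<^sub>2 (cos t) (-1) < sin t / t" "sin t / t < H\<^sub>1 (cos t) (-1)"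
    using open_range[of "-2"] by auto
  then show "H\<^sub>2 (cos t) p < sin t / t" "sin t / t < H\<^sub>1 (cos t) p"
    using open_range[of p] p by (cases "p = -1"; auto)+
qed

text \<open>
  Both sides of \<open>m * H\<^sub>1 (cos t) p < sin t / t\<close> have limits as \<open>t\<close> tends to \<open>\<pi>/2\<close>, namely
  \<open>m * (2 * p / (3 * p + 1))\<close> and \<open>2 / \<pi>\<close>; comparing them bounds \<open>m\<close>.
\<close>

lemma lambda_best_possible:
  assumes p: "p \<in> {..-1} \<union> {9..}"
  shows "best_possible_const p (lambda_const p)"
  unfolding best_possible_const_def
proof (intro conjI allI impI)
  show "admissible_const p (lambda_const p)"
    unfolding admissible_const_def using two_sided_bound(1)[OF p] by (simp add: H2_eq_lambda_H1)
next
  fix m assume m: "admissible_const p m"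
  have nz: "3 * p + 1 \<noteq> 0" "p \<noteq> 0" using p by auto
  have "continuous (at (pi/2)) (\<lambda>t. m * H\<^sub>1 (cos t) p)"
    unfolding H\<^sub>1_def using nz by (intro continuous_intros) auto
  then have "((\<lambda>t. m * H\<^sub>1 (cos t) p) \<longlongrightarrow> m * H\<^sub>1 (cos (pi/2)) p) (at_left (pi/2))"
    using continuous_at_imp_continuous_at_within continuous_within by blast
  moreover have "continuous (at (pi/2)) (\<lambda>t::real. sin t / t)"
    by (intro continuous_intros) auto
  then have "((\<lambda>t. sin t / t) \<longlongrightarrow> sin (pi/2) / (pi/2)) (at_left (pi/2))"
    using continuous_at_imp_continuous_at_within continuous_within by blast
  moreover have "eventually (\<lambda>t. t \<in> {0<..<pi/2}) (at_left (pi/2))"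
    by (intro eventually_at_leftI[of 0]) auto
  then have "eventually (\<lambda>t. m * H\<^sub>1 (cos t) p \<le> sin t / t) (at_left (pi/2))"
    by eventually_elim (use m in \<open>auto simp: admissible_const_def less_imp_le\<close>)
  ultimately have "m * H\<^sub>1 (cos (pi/2)) p \<le> sin (pi/2) / (pi/2)"
    by (intro tendsto_le[where F = "at_left (pi/2)"]) auto
  then have le: "m * (2 * p / (3 * p + 1)) \<le> 2 / pi" by (simp add: H\<^sub>1_def)
  have "0 < 2 * p / (3 * p + 1)" using p by (auto simp: zero_less_divide_iff)
  then have "m \<le> 2 / pi / (2 * p / (3 * p + 1))" using le by (simp only: pos_le_divide_eq)
  also have "\<dots> = lambda_const p" using nz by (simp add: lambda_const_def field_simps)
  finally show "m \<le> lambda_const p" .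
qed

lemma upper_bound_iff:
  assumes p: "p \<in> {..-1} \<union> {0..}"
  shows "(\<forall>t\<in>{0<..<pi/2}. sin t / t < H\<^sub>1 (cos t) p) \<longleftrightarrow> p \<in> {..-1} \<union> {9..}"
proof
  assume bound: "\<forall>t\<in>{0<..<pi/2}. sin t / t < H\<^sub>1 (cos t) p"
  have "\<not> (0 \<le> p \<and> p < 9)"
  proof
    assume "0 \<le> p \<and> p < 9"
    then obtain t where "t \<in> {0<..<pi/2}" "H\<^sub>1 (cos t) p < sin t / t"
      using upper_bound_fails[of p] by (auto simp: H1_eq_num_den)
    then show False using bound less_asym by blast
  qed
  then show "p \<in> {..-1} \<union> {9..}" using p by auto
next
  assume "p \<in> {..-1} \<union> {9..}"
  then show "\<forall>t\<in>{0<..<pi/2}. sin t / t < H\<^sub>1 (cos t) p"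
    by (intro ballI two_sided_bound(2))
qed

theorem theorem1:
  shows "(\<forall>p::real. p \<in> {..-1} \<union> {0..} \<longrightarrow>
            ((\<forall>t\<in>{0<..<pi/2}.
                sin t / t < (2 * p + (p + 3) * cos t) / ((3 * p + 1) + 2 * cos t))
             \<longleftrightarrow> p \<in> {..-1} \<union> {9..}))
       \<and> (\<forall>p::real. p \<in> {..-1} \<union> {9..} \<longrightarrow>
            (\<forall>t\<in>{0<..<pi/2}.
                H\<^sub>2 (cos t) p
                  = lambda_const p * ((2 * p + (p + 3) * cos t) / ((3 * p + 1) + 2 * cos t))
              \<and> lambda_const p * ((2 * p + (p + 3) * cos t) / ((3 * p + 1) + 2 * cos t))
                  < sin t / t
              \<and> sin t / t < (2 * p + (p + 3) * cos t) / ((3 * p + 1) + 2 * cos t)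
              \<and> (2 * p + (p + 3) * cos t) / ((3 * p + 1) + 2 * cos t) = H\<^sub>1 (cos t) p)
            \<and> best_possible_const p (lambda_const p))
       \<and> (\<forall>t\<in>{0<..<pi/2}.
              strict_antimono_on {..-1} (\<lambda>p. H\<^sub>2 (cos t) p)
            \<and> strict_antimono_on {0<..} (\<lambda>p. H\<^sub>2 (cos t) p)
            \<and> strict_mono_on {..-1} (\<lambda>p. H\<^sub>1 (cos t) p)
            \<and> strict_mono_on {0<..} (\<lambda>p. H\<^sub>1 (cos t) p))"
proof (intro conjI allI impI ballI)
  fix p :: real assume "p \<in> {..-1} \<union> {0..}"
  then show "(\<forall>t\<in>{0<..<pi/2}.
        sin t / t < (2 * p + (p + 3) * cos t) / ((3 * p + 1) + 2 * cos t))
      \<longleftrightarrow> p \<in> {..-1} \<union> {9..}"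
    by (rule upper_bound_iff[unfolded H\<^sub>1_def])
next
  fix p t :: real assume pt: "p \<in> {..-1} \<union> {9..}" "t \<in> {0<..<pi/2}"
  show "H\<^sub>2 (cos t) p
      = lambda_const p * ((2 * p + (p + 3) * cos t) / ((3 * p + 1) + 2 * cos t))"
    by (simp add: H\<^sub>2_def lambda_const_def)
  then show "lambda_const p * ((2 * p + (p + 3) * cos t) / ((3 * p + 1) + 2 * cos t)) < sin t / t"
    using two_sided_bound(1)[OF pt] by simp
  show "sin t / t < (2 * p + (p + 3) * cos t) / ((3 * p + 1) + 2 * cos t)"
    using two_sided_bound(2)[OF pt] by (simp add: H\<^sub>1_def)
  show "(2 * p + (p + 3) * cos t) / ((3 * p + 1) + 2 * cos t) = H\<^sub>1 (cos t) p"
    by (simp add: H\<^sub>1_def)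
next
  fix p :: real assume "p \<in> {..-1} \<union> {9..}"
  then show "best_possible_const p (lambda_const p)" by (rule lambda_best_possible)
next
  fix t :: real assume t: "t \<in> {0<..<pi/2}"
  note c = cos_unit_interval[OF t]
  show "strict_antimono_on {..-1} (\<lambda>p. H\<^sub>2 (cos t) p)" by (rule H2_strict_antimono_neg[OF c])
  show "strict_antimono_on {0<..} (\<lambda>p. H\<^sub>2 (cos t) p)" by (rule H2_strict_antimono_pos[OF c])
  show "strict_mono_on {..-1} (\<lambda>p. H\<^sub>1 (cos t) p)" by (rule H1_strict_mono_neg[OF c(2)])
  show "strict_mono_on {0<..} (\<lambda>p. H\<^sub>1 (cos t) p)"
    by (rule H1_strict_mono_pos[OF less_imp_le[OF c(1)] c(2)])
qed

end
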